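(* Let $m,n$ be positive integers and let $(S,T)$ be a pair of random variables on a common probability space taking values in $\{0,1,\dots,m\}\times\{0,1,\dots,n\}$. Put $S_{i,j}=E\left[\binom{S}{i}\binom{T}{j}\right]$ and, for integers $1\le s\le k\le m$ and $1\le t\le l\le n$, $$A^{(s,t)}_{k,l}=\frac{\displaystyle\sum_{i=s}^{k}\sum_{j=t}^{l}(-1)^{i+j-(s+t)}\binom{i-1}{i-s}\binom{m-i}{k-i}\binom{j-1}{j-t}\binom{n-j}{l-j}S_{i,j}}{\binom{m-s}{k-s}\binom{n-t}{l-t}}.$$ Then for all integers $1\le s\le m-1$ and $1\le t\le n$, $$P(S\ge s,T\ge t)\ \le\ A^{(s,t)}_{m-1,n}.$$
   Context: For non-negative integers $a,r$, $\binom{a}{r}$ is the usual binomial coefficient, with $\binom{a}{0}=1$ and $\binom{a}{r}=0$ if $r>a$. $E$ denotes expectation. *)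

theory Defs
  imports "HOL-Probability.Probability"
begin

definition joint_binomial_moment ::
    "'a measure \<Rightarrow> ('a \<Rightarrow> nat) \<Rightarrow> ('a \<Rightarrow> nat) \<Rightarrow> nat \<Rightarrow> nat \<Rightarrow> real"
  where "joint_binomial_moment M S T i j =
    (LINT \<omega>|M. real (S \<omega> choose i) * real (T \<omega> choose j))"

text \<open>
  Meant for \<open>1 \<le> s \<le> k \<le> m\<close> and \<open>1 \<le> t \<le> l \<le> n\<close>. In that range no
  subtraction on natural numbers is truncated and the denominator is positive.
\<close>
definition bonferroni_A ::
    "'a measure \<Rightarrow> ('a \<Rightarrow> nat) \<Rightarrow> ('a \<Rightarrow> nat) \<Rightarrow> nat \<Rightarrow> nat \<Rightarrow> nat \<Rightarrow> nat \<Rightarrow> nat \<Rightarrow> nat \<Rightarrow> real"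
  where "bonferroni_A M S T m n s t k l =
    (\<Sum>i=s..k. \<Sum>j=t..l.
       (-1) ^ (i + j - (s + t))
       * real ((i - 1) choose (i - s)) * real ((m - i) choose (k - i))
       * real ((j - 1) choose (j - t)) * real ((n - j) choose (l - j))
       * joint_binomial_moment M S T i j)
    / (real ((m - s) choose (k - s)) * real ((n - t) choose (l - t)))"

end

(*
  The weights of A^(s,t)_{m-1,n} factor, so A^(s,t)_{m-1,n} = E[F(S) G(T)] for
    G(b) = sum_j (-1)^(j-t) C(j-1,j-t) C(b,j) = [t <= b],
    F(a) = sum_i (-1)^(i-s) C(i-1,i-s) (m-i) C(a,i) / (m-s).
  Since (m-i) C(a,i) = (m-a) C(a,i) + a C(a-1,i), the identity for G also gives
  (m-s) F(a) = (m-a) [s <= a] + a [s <= a-1], which is at least (m-s) [s <= a].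
  The bound therefore holds pointwise.
*)
theory Submission imports Defs begin

text \<open>Binomial inversion. Trinomial revision C(a,k) C(k,r) = C(a,r) C(a-r,k-r) pulls C(a,r)
  out of the sum; what remains is the alternating sum of row a-r of Pascal's triangle, which
  vanishes unless that row is row 0.\<close>

lemma alternating_binomial_orthogonality:
  fixes a r N :: nat
  assumes "a \<le> N"
  shows "(\<Sum>k=r..N. (-1) ^ (k - r) * real (k choose r) * real (a choose k)) = of_bool (a = r)"
proof (cases "r \<le> a")
  case False
  then show ?thesis
    by (auto intro!: sum.neutral)
next
  case True
  have "(\<Sum>k=r..N. (-1) ^ (k - r) * real (k choose r) * real (a choose k))
      = (\<Sum>k=r..a. (-1) ^ (k - r) * real (k choose r) * real (a choose k))"
    using assms by (intro sum.mono_neutral_right) auto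
  also have "\<dots> = (\<Sum>k=r..a. real (a choose r) * ((-1) ^ (k - r) * real ((a - r) choose (k - r))))"
  proof (rule sum.cong[OF refl])
    fix k assume "k \<in> {r..a}"
    then have "(a choose k) * (k choose r) = (a choose r) * ((a - r) choose (k - r))"
      by (intro choose_mult) auto
    then have "real (a choose k) * real (k choose r) = real (a choose r) * real ((a - r) choose (k - r))"
      by (metis of_nat_mult)
    then show "(-1) ^ (k - r) * real (k choose r) * real (a choose k)
      = real (a choose r) * ((-1) ^ (k - r) * real ((a - r) choose (k - r)))"
      by (simp add: mult_ac)
  qed
  also have "\<dots> = real (a choose r) * (\<Sum>k=r..a. (-1) ^ (k - r) * real ((a - r) choose (k - r)))"
    by (simp add: sum_distrib_left)
  also have "(\<Sum>k=r..a. (-1) ^ (k - r) * real ((a - r) choose (k - r)))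
      = (\<Sum>l\<le>a - r. (-1) ^ l * real ((a - r) choose l))"
    using True
    by (intro sum.reindex_bij_witness[of _ "\<lambda>l. l + r" "\<lambda>k. k - r"]) auto
  also have "real (a choose r) * \<dots> = of_bool (a = r)"
    using True choose_alternating_sum[of "a - r", where 'a = real] by (cases "a = r") auto
  finally show ?thesis .
qed

text \<open>Induction on \<open>a\<close>. By Pascal's rule, passing from \<open>a\<close> to
  \<open>Suc a\<close> adds the same sum with C(a,i-1) in place of C(a,i). By orthogonality this
  increment is 1 exactly at a = s-1, where the indicator of s \<le> a jumps.\<close>

lemma alternating_binomial_tail:
  fixes a s N :: nat
  assumes "1 \<le> s" and "a \<le> N"
  shows "(\<Sum>i=s..N. (-1) ^ (i - s) * real ((i - 1) choose (i - s)) * real (a choose i))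
    = of_bool (s \<le> a)"
  using assms(2)
proof (induction a)
  case 0
  then show ?case
    using assms(1) by (auto intro!: sum.neutral)
next
  case (Suc a)
  obtain r where r: "s = Suc r"
    using assms(1) by (cases s) auto
  obtain N' where N': "N = Suc N'"
    using Suc.prems by (cases N) auto
  let ?c = "\<lambda>i. (-1) ^ (i - s) * real ((i - 1) choose (i - s))"
  have "(\<Sum>i=s..N. ?c i * real (Suc a choose i))
      = (\<Sum>i=s..N. ?c i * real (a choose i)) + (\<Sum>i=s..N. ?c i * real (a choose (i - 1)))"
    unfolding sum.distrib[symmetric]
  proof (rule sum.cong[OF refl])
    fix i assume "i \<in> {s..N}"
    then obtain k where "i = Suc k"
      using r by (cases i) auto
    then show "?c i * real (Suc a choose i)
      = ?c i * real (a choose i) + ?c i * real (a choose (i - 1))"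
      by (simp add: algebra_simps)
  qed
  \<comment> \<open>With i = k+1 and s = r+1 the weight C(i-1,i-s) becomes C(k,k-r) = C(k,r), the
    one in the orthogonality relation.\<close>
  also have "(\<Sum>i=s..N. ?c i * real (a choose (i - 1)))
      = (\<Sum>k=r..N'. (-1) ^ (k - r) * real (k choose (k - r)) * real (a choose k))"
    unfolding r N' sum.shift_bounds_cl_Suc_ivl by simp
  also have "\<dots> = (\<Sum>k=r..N'. (-1) ^ (k - r) * real (k choose r) * real (a choose k))"
    by (intro sum.cong refl) (simp add: binomial_symmetric[symmetric])
  also have "\<dots> = of_bool (a = r)"
    using Suc.prems N' by (intro alternating_binomial_orthogonality) simp
  finally show ?case
    using Suc r by auto
qed

text \<open>The extra weight is just m-i. Writing it as (m-a) + (a-i) and absorbing a-i into the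
  binomial leaves two tail sums, one for \<open>a\<close> and one for \<open>a - 1\<close>.\<close>

lemma weighted_alternating_binomial_tail:
  fixes a s m :: nat
  assumes "1 \<le> s" and "a \<le> m"
  shows "(\<Sum>i=s..m-1. (-1) ^ (i - s) * real ((i - 1) choose (i - s))
      * real ((m - i) choose (m - 1 - i)) * real (a choose i))
    = (real m - real a) * of_bool (s \<le> a) + real a * of_bool (s \<le> a - 1)"
proof -
  let ?c = "\<lambda>i. (-1) ^ (i - s) * real ((i - 1) choose (i - s))"
  \<comment> \<open>Stated over the reals, this also covers i > a, where a-i is negative but both
    binomials vanish, and a = 0, where the truncated \<open>a - 1\<close> is multiplied by
    0.\<close>
  have absorb: "(real a - real i) * real (a choose i) = real a * real ((a - 1) choose i)" for i
  proof (cases a)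
    case (Suc b)
    show ?thesis
    proof (cases "i \<le> a")
      case True
      have "(a - i) * (a choose i) = a * ((a - 1) choose i)"
        using binomial_absorb_comp[of a i] .
      then show ?thesis
        using True by (metis of_nat_diff of_nat_mult)
    qed (use Suc in \<open>simp add: binomial_eq_0\<close>)
  qed (cases i, auto)
  have "(\<Sum>i=s..m-1. ?c i * real ((m - i) choose (m - 1 - i)) * real (a choose i))
      = (\<Sum>i=s..m-1. ?c i * (real m - real i) * real (a choose i))"
  proof (rule sum.cong[OF refl])
    fix i assume "i \<in> {s..m-1}"
    then have i: "Suc i \<le> m"
      using assms(1) by auto
    have "(m - i) choose (m - 1 - i) = (m - i) choose 1"
      using i binomial_symmetric[of 1 "m - i"] by (simp add: diff_right_commute)
    then show "?c i * real ((m - i) choose (m - 1 - i)) * real (a choose i)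
      = ?c i * (real m - real i) * real (a choose i)"
      using i by (simp add: of_nat_diff)
  qed
  \<comment> \<open>The term i = m is free, as its factor m-i is 0. It is needed because the tail
    identity requires an upper limit of at least \<open>a\<close>, and \<open>a\<close> may equal
    \<open>m\<close>.\<close>
  also have "\<dots> = (\<Sum>i=s..m. ?c i * (real m - real i) * real (a choose i))"
    by (rule sum.mono_neutral_left) (auto dest: not_le_imp_less)
  also have "\<dots> = (\<Sum>i=s..m. (real m - real a) * (?c i * real (a choose i))
      + real a * (?c i * real ((a - 1) choose i)))"
  proof (rule sum.cong[OF refl])
    fix i
    have "?c i * (real m - real i) * real (a choose i)
      = (real m - real a) * (?c i * real (a choose i))
        + ?c i * ((real a - real i) * real (a choose i))"
      by (simp add: algebra_simps)
    then show "?c i * (real m - real i) * real (a choose i)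
      = (real m - real a) * (?c i * real (a choose i))
        + real a * (?c i * real ((a - 1) choose i))"
      unfolding absorb by (simp add: mult_ac)
  qed
  also have "\<dots> = (real m - real a) * of_bool (s \<le> a) + real a * of_bool (s \<le> a - 1)"
    using alternating_binomial_tail[OF assms]
      alternating_binomial_tail[OF assms(1) le_trans[OF diff_le_self assms(2)], of 1]
    by (simp only: sum.distrib sum_distrib_left[symmetric])
  finally show ?thesis .
qed

theorem mainTheorem9:
  fixes M :: "'a measure" and S T :: "'a \<Rightarrow> nat" and m n s t :: nat
  assumes "prob_space M"
    and "1 \<le> m" and "1 \<le> n"
    and "S \<in> measurable M (count_space UNIV)"
    and "T \<in> measurable M (count_space UNIV)"
    and "\<And>\<omega>. \<omega> \<in> space M \<Longrightarrow> S \<omega> \<in> {0..m} \<and> T \<omega> \<in> {0..n}"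
    and "1 \<le> s" and "s \<le> m - 1"
    and "1 \<le> t" and "t \<le> n"
  shows "\<P>(\<omega> in M. s \<le> S \<omega> \<and> t \<le> T \<omega>) \<le> bonferroni_A M S T m n s t (m - 1) n"
proof -
  interpret prob_space M by fact
  note [measurable] = assms(4,5)
  define f where "f = (\<lambda>i. (-1) ^ (i - s) * real ((i - 1) choose (i - s))
    * real ((m - i) choose (m - 1 - i)))"
  define g where "g = (\<lambda>j. (-1) ^ (j - t) * real ((j - 1) choose (j - t)))"
  define B where "B = (\<lambda>i j \<omega>. real (S \<omega> choose i) * real (T \<omega> choose j))"
  have sm: "s < m"
    using assms(2,8) by linarith
  have denominator: "real ((m - s) choose (m - 1 - s)) = real (m - s)"
    using sm binomial_symmetric[of 1 "m - s"] by (simp add: diff_right_commute)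
  \<comment> \<open>Integrability is what lets expectation commute with the finite sums below. The
    bound comes from C(a,i) \<le> 2^a together with S \<le> m and T \<le> n.\<close>
  have B_int: "integrable M (B i j)" for i j
  proof (rule integrable_const_bound[where B = "2 ^ m * 2 ^ n"])
    show "B i j \<in> borel_measurable M"
      unfolding B_def by measurable
    show "AE \<omega> in M. norm (B i j \<omega>) \<le> 2 ^ m * 2 ^ n"
    proof (rule AE_I2)
      fix \<omega> assume "\<omega> \<in> space M"
      then have "S \<omega> choose i \<le> 2 ^ m" "T \<omega> choose j \<le> 2 ^ n"
        using assms(6)[of \<omega>]
        by (auto intro: order_trans[OF binomial_le_pow2 power_increasing])
      then have "(S \<omega> choose i) * (T \<omega> choose j) \<le> 2 ^ m * 2 ^ n"
        by (rule mult_le_mono)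
      then have "real ((S \<omega> choose i) * (T \<omega> choose j)) \<le> real (2 ^ m * 2 ^ n)"
        by (simp only: of_nat_le_iff)
      then show "norm (B i j \<omega>) \<le> 2 ^ m * 2 ^ n"
        by (simp add: B_def)
    qed
  qed
  \<comment> \<open>This is F(S) G(T), kept expanded so that linearity gives its integral term by
    term; it is factored only pointwise.\<close>
  define H where "H = (\<lambda>\<omega>. (\<Sum>i=s..m-1. \<Sum>j=t..n. f i * g j * B i j \<omega>) / real (m - s))"
  have H_int: "integrable M H"
    unfolding H_def using B_int by simp
  have "bonferroni_A M S T m n s t (m - 1) n
      = (\<Sum>i=s..m-1. \<Sum>j=t..n. f i * g j * (LINT \<omega>|M. B i j \<omega>)) / real (m - s)"
  proof -
    \<comment> \<open>The sign splits only because s \<le> i and t \<le> j keep the natural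
      subtractions from being truncated.\<close>
    have "(-1::real) ^ (i + j - (s + t)) = (-1) ^ (i - s) * (-1) ^ (j - t)"
      if "s \<le> i" "t \<le> j" for i j
      using that by (simp flip: power_add)
    then show ?thesis
      unfolding bonferroni_A_def joint_binomial_moment_def denominator
      by (auto simp: f_def g_def B_def mult_ac intro!: arg_cong2[where f = "(/)"] sum.cong)
  qed
  also have "\<dots> = (LINT \<omega>|M. H \<omega>)"
    unfolding H_def using B_int by (simp add: Bochner_Integration.integral_sum)
  finally have A_eq: "bonferroni_A M S T m n s t (m - 1) n = (LINT \<omega>|M. H \<omega>)" .
  let ?E = "{\<omega> \<in> space M. s \<le> S \<omega> \<and> t \<le> T \<omega>}"
  have "prob ?E = (LINT \<omega>|M. indicator ?E \<omega>)"
    by simp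
  also have "\<dots> \<le> (LINT \<omega>|M. H \<omega>)"
  proof (rule integral_mono[OF _ H_int])
    show "integrable M (indicator ?E :: 'a \<Rightarrow> real)"
      by (simp add: integrable_indicator_iff emeasure_eq_measure)
    fix \<omega> assume \<omega>: "\<omega> \<in> space M"
    define a b where "a = S \<omega>" and "b = T \<omega>"
    have ab: "a \<le> m" "b \<le> n"
      using assms(6)[OF \<omega>] by (auto simp: a_def b_def)
    have "(\<Sum>i=s..m-1. \<Sum>j=t..n. f i * g j * B i j \<omega>)
        = (\<Sum>i=s..m-1. f i * real (a choose i)) * (\<Sum>j=t..n. g j * real (b choose j))"
      unfolding sum_product by (simp add: B_def a_def b_def mult_ac)
    also have "(\<Sum>i=s..m-1. f i * real (a choose i))
        = (real m - real a) * of_bool (s \<le> a) + real a * of_bool (s \<le> a - 1)"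
      unfolding f_def using assms(7) ab(1) by (rule weighted_alternating_binomial_tail)
    also have "(\<Sum>j=t..n. g j * real (b choose j)) = of_bool (t \<le> b)"
      unfolding g_def using assms(9) ab(2) by (rule alternating_binomial_tail)
    finally have H: "H \<omega> = ((real m - real a) * of_bool (s \<le> a) + real a * of_bool (s \<le> a - 1))
        * of_bool (t \<le> b) / real (m - s)"
      by (simp add: H_def)
    \<comment> \<open>When t \<le> b, the value of \<open>H\<close> is 0 for a < s, exactly 1 for a
      = s (only the m-a term survives), and ((m-a) + a)/(m-s) = m/(m-s) \<ge> 1 for a > s. Otherwise
      both sides are 0.\<close>
    consider "a < s" | "a = s" | "s < a"
      by linarith
    then have "of_bool (s \<le> a \<and> t \<le> b) \<le> H \<omega>"
    proof cases
      case 2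
      then show ?thesis
        unfolding H using sm assms(7) by (auto simp: of_nat_diff)
    next
      case 3
      then show ?thesis
        unfolding H using sm by (auto simp: of_nat_diff field_simps)
    qed (auto simp: H)
    then show "indicator ?E \<omega> \<le> H \<omega>"
      using \<omega> by (simp add: indicator_def a_def b_def)
  qed
  finally show ?thesis
    unfolding A_eq .
qed

end
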